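(* For all $s,t,w\in\mathbb{N}$, there exists $\eta\in\mathbb{N}$ such that every graph with treewidth at most $w$ and with no $K_{s,t}$ subgraph is $(s+1)$-choosable with clustering $\eta$.
   Context: $\mathbb{N}=\{1,2,\dots\}$. Graphs are finite and may have loops and parallel edges; subgraphs are not required to be induced. Treewidth is the usual notion (minimum over tree decompositions of the maximum bag size minus 1). A color is an element of $\mathbb{Z}$. A list-assignment $L$ of a graph $G$ assigns to each vertex $v$ a non-empty set $L(v)$ of colors; it is an $\ell$-list-assignment if $|L(v)|\geq \ell$ for every $v\in V(G)$. An $L$-coloring of $G$ is a function $c$ on $V(G)$ with $c(v)\in L(v)$ for every $v$ (not necessarily proper). A monochromatic component with respect to $c$ is a connected component of the subgraph of $G$ induced by all the vertices assigned a single color. A coloring has clustering $\eta$ if every monochromatic component has at most $\eta$ vertices. $G$ is $\ell$-choosable with clustering $\eta$ if for every $\ell$-list-assignment $L$ of $G$ there is an $L$-coloring of $G$ with clustering $\eta$. *)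

theory Defs
  imports Main "HOL-Library.Uprod"
begin

text \<open>Undirected multigraphs: distinct edges may have the same ends (parallel edges), and an
  edge with ends \<open>Upair v v\<close> is a loop.  The value of \<open>ends\<close> outside \<open>edges\<close> is irrelevant.\<close>

record ('v, 'e) mgraph =
  verts :: "'v set"
  edges :: "'e set"
  ends :: "'e \<Rightarrow> 'v uprod"

definition fin_mgraph :: "('v, 'e) mgraph \<Rightarrow> bool" where
  "fin_mgraph G \<longleftrightarrow> finite (verts G) \<and> finite (edges G) \<and>
     (\<forall>e\<in>edges G. set_uprod (ends G e) \<subseteq> verts G)"

definition subgraph :: "('v, 'e) mgraph \<Rightarrow> ('v, 'e) mgraph \<Rightarrow> bool" where
  "subgraph H G \<longleftrightarrow> fin_mgraph H \<and> verts H \<subseteq> verts G \<and> edges H \<subseteq> edges G \<and>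
     (\<forall>e\<in>edges H. ends H e = ends G e)"

definition induced :: "('v, 'e) mgraph \<Rightarrow> 'v set \<Rightarrow> ('v, 'e) mgraph" where
  "induced G S = \<lparr>verts = verts G \<inter> S,
                  edges = {e \<in> edges G. set_uprod (ends G e) \<subseteq> S},
                  ends = ends G\<rparr>"

definition isomorphic :: "('v, 'e) mgraph \<Rightarrow> ('w, 'f) mgraph \<Rightarrow> bool" where
  "isomorphic G H \<longleftrightarrow> (\<exists>f g. bij_betw f (verts G) (verts H) \<and> bij_betw g (edges G) (edges H) \<and>
     (\<forall>e\<in>edges G. ends H (g e) = map_uprod f (ends G e)))"

definition contains_copy :: "('v, 'e) mgraph \<Rightarrow> ('w, 'f) mgraph \<Rightarrow> bool" where
  "contains_copy G K \<longleftrightarrow> (\<exists>H. subgraph H G \<and> isomorphic K H)"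

definition complete_bipartite :: "nat \<Rightarrow> nat \<Rightarrow> (nat + nat, nat \<times> nat) mgraph" where
  "complete_bipartite s t =
     \<lparr>verts = {..<s} <+> {..<t},
      edges = {..<s} \<times> {..<t},
      ends = (\<lambda>(i, j). Upair (Inl i) (Inr j))\<rparr>"

text \<open>For \<open>n = 1\<close> this is a loop, and for \<open>n = 2\<close> a pair of parallel edges.\<close>

definition cycle_graph :: "nat \<Rightarrow> (nat, nat) mgraph" where
  "cycle_graph n =
     \<lparr>verts = {..<n},
      edges = {..<n},
      ends = (\<lambda>i. Upair i (Suc i mod n))\<rparr>"

definition adj_rel :: "('v, 'e) mgraph \<Rightarrow> ('v \<times> 'v) set" where
  "adj_rel G = {(u, v). \<exists>e\<in>edges G. ends G e = Upair u v}"

definition connected_graph :: "('v, 'e) mgraph \<Rightarrow> bool" where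
  "connected_graph G \<longleftrightarrow> verts G \<noteq> {} \<and> (\<forall>u\<in>verts G. \<forall>v\<in>verts G. (u, v) \<in> (adj_rel G)\<^sup>*)"

text \<open>The vertex sets of the connected components.\<close>

definition components_of :: "('v, 'e) mgraph \<Rightarrow> 'v set set" where
  "components_of G = verts G // (adj_rel G)\<^sup>*"

definition tree_graph :: "('v, 'e) mgraph \<Rightarrow> bool" where
  "tree_graph T \<longleftrightarrow> fin_mgraph T \<and> connected_graph T \<and>
     (\<forall>n\<ge>1. \<not> contains_copy T (cycle_graph n))"

text \<open>Every finite tree is isomorphic to one whose nodes and edges are natural numbers, so only
  such trees are used to index the bags.\<close>

definition tree_decomposition ::
    "('v, 'e) mgraph \<Rightarrow> (nat, nat) mgraph \<Rightarrow> (nat \<Rightarrow> 'v set) \<Rightarrow> bool" where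
  "tree_decomposition G T B \<longleftrightarrow> tree_graph T \<and>
     (\<Union>x\<in>verts T. B x) = verts G \<and>
     (\<forall>e\<in>edges G. \<exists>x\<in>verts T. set_uprod (ends G e) \<subseteq> B x) \<and>
     (\<forall>v\<in>verts G. connected_graph (induced T {x \<in> verts T. v \<in> B x}))"

text \<open>Subtraction is truncated, so the graph without vertices gets treewidth \<open>0\<close> instead
  of \<open>-1\<close>; the two agree on being at most \<open>w\<close> for every natural number \<open>w\<close>.\<close>

definition decomposition_width :: "(nat, nat) mgraph \<Rightarrow> (nat \<Rightarrow> 'v set) \<Rightarrow> nat" where
  "decomposition_width T B = Max ((\<lambda>x. card (B x)) ` verts T) - 1"

definition treewidth :: "('v, 'e) mgraph \<Rightarrow> nat" where
  "treewidth G = (LEAST k. \<exists>T B. tree_decomposition G T B \<and> decomposition_width T B = k)"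

text \<open>Infinite lists are allowed; their \<open>card\<close> is \<open>0\<close>, hence the guard.\<close>

definition list_assignment :: "nat \<Rightarrow> ('v, 'e) mgraph \<Rightarrow> ('v \<Rightarrow> int set) \<Rightarrow> bool" where
  "list_assignment l G L \<longleftrightarrow>
     (\<forall>v\<in>verts G. L v \<noteq> {} \<and> (finite (L v) \<longrightarrow> l \<le> card (L v)))"

definition list_coloring :: "('v, 'e) mgraph \<Rightarrow> ('v \<Rightarrow> int set) \<Rightarrow> ('v \<Rightarrow> int) \<Rightarrow> bool" where
  "list_coloring G L c \<longleftrightarrow> (\<forall>v\<in>verts G. c v \<in> L v)"

definition monochromatic_components :: "('v, 'e) mgraph \<Rightarrow> ('v \<Rightarrow> int) \<Rightarrow> 'v set set" where
  "monochromatic_components G c = (\<Union>a. components_of (induced G {v \<in> verts G. c v = a}))"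

definition has_clustering :: "('v, 'e) mgraph \<Rightarrow> ('v \<Rightarrow> int) \<Rightarrow> nat \<Rightarrow> bool" where
  "has_clustering G c \<eta> \<longleftrightarrow> (\<forall>X\<in>monochromatic_components G c. card X \<le> \<eta>)"

definition choosable_with_clustering :: "('v, 'e) mgraph \<Rightarrow> nat \<Rightarrow> nat \<Rightarrow> bool" where
  "choosable_with_clustering G l \<eta> \<longleftrightarrow>
     (\<forall>L. list_assignment l G L \<longrightarrow> (\<exists>c. list_coloring G L c \<and> has_clustering G c \<eta>))"

end

theory Submission
  imports Defs
begin

text \<open>
  Call a vertex heavy for a set \<open>Y\<close> if it has at least \<open>s\<close> neighbours in \<open>Y\<close>; as there is no
  \<open>K\<^sub>s\<^sub>,\<^sub>t\<close>, boundedly many vertices are heavy for a bounded set. Let \<open>Y\<^sub>0\<close> be a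
  bounded precoloured set with colours \<open>c\<^sub>1, ..., c\<^sub>m\<close>. In round \<open>j\<close> colour the heavy vertices of
  \<open>Y\<^sub>j\<^sub>-\<^sub>1\<close> and add them to obtain \<open>Y\<^sub>j\<close>. Such a vertex was not heavy one round before, so with
  \<open>s + 1\<close> colours it can avoid the colours of its at most \<open>s - 1\<close> neighbours in \<open>Y\<^sub>j\<^sub>-\<^sub>2\<close> and
  in addition \<open>c\<^sub>j\<close>. Hence a monochromatic component of colour \<open>c\<^sub>j\<close> that meets \<open>Y\<^sub>0\<close> gains one
  layer per round and is stopped in round \<open>j\<close>, so it stays in \<open>Y\<^sub>m\<close>, as long as the remaining
  vertices, none of them heavy for \<open>Y\<^sub>m\<^sub>-\<^sub>1\<close>, avoid the colours of their neighbours there.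

  Bounded treewidth keeps the precoloured set bounded: \<open>Y\<^sub>m\<close> lies in a bounded set \<open>S'\<close> such
  that each part of the remaining graph attaches to at most two bags. Colour \<open>S'\<close> and recurse
  into each part with its attachments precoloured. Only the boundedly many parts that contain a heavy
  vertex of \<open>S'\<close> can extend a component meeting \<open>S'\<close>.
\<close>

section \<open>List colouring along small separators\<close>

text \<open>The cluster of \<open>v\<close> is its image under the reflexive transitive closure of
  this relation. No colour class has to be named, and \<open>V\<close> can shrink to a part of the
  graph.\<close>

definition mono_rel :: "('v \<Rightarrow> 'v \<Rightarrow> bool) \<Rightarrow> 'v set \<Rightarrow> ('v \<Rightarrow> 'c) \<Rightarrow> ('v \<times> 'v) set" where
  "mono_rel E V c = {(u, v). u \<in> V \<and> v \<in> V \<and> E u v \<and> c u = c v}"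

lemma mono_rel_reach:
  assumes "(u, v) \<in> (mono_rel E V c)\<^sup>*" and "u \<in> V"
  shows "v \<in> V"
  using assms by (induction rule: rtrancl_induct) (auto simp: mono_rel_def)

text \<open>\<open>Y\<close> itself is included so that iteration gives an increasing chain.\<close>

definition heavy :: "('v \<Rightarrow> 'v \<Rightarrow> bool) \<Rightarrow> nat \<Rightarrow> 'v set \<Rightarrow> 'v set \<Rightarrow> 'v set" where
  "heavy E s V Y = Y \<union> {v \<in> V. s \<le> card {u \<in> Y. E u v}}"

lemma heavy_subset: "Y \<subseteq> V \<Longrightarrow> heavy E s V Y \<subseteq> V"
  by (auto simp: heavy_def)

lemma heavy_iter_subset: "Y \<subseteq> V \<Longrightarrow> (heavy E s V ^^ j) Y \<subseteq> V"
  by (induction j) (auto dest: heavy_subset[THEN subsetD, rotated])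

lemma heavy_iter_mono: "i \<le> j \<Longrightarrow> (heavy E s V ^^ i) Y \<subseteq> (heavy E s V ^^ j) Y"
  by (induction j rule: dec_induct) (auto simp: heavy_def)

lemma heavy_iter_fixed: "heavy E s V Y \<subseteq> Y \<Longrightarrow> (heavy E s V ^^ j) Y = Y"
  by (induction j) (auto simp: heavy_def)

definition growth :: "nat \<Rightarrow> nat \<Rightarrow> nat" where
  "growth t n = n + 2 ^ n * t"

lemma growth_mono: "m \<le> n \<Longrightarrow> growth t m \<le> growth t n"
  by (simp add: growth_def add_mono mult_le_mono1)

text \<open>\<open>\<theta>\<close> has two roles: it bounds the precoloured set, hence also the
  number of its colours, which is the number of rounds.\<close>

definition reach_bound :: "nat \<Rightarrow> nat \<Rightarrow> nat" where
  "reach_bound t \<theta> = (growth t ^^ \<theta>) \<theta>"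

text \<open>The summands cover, in order, a fully precoloured part, the enlarged separator
  \<open>Z\<close>, and what clusters meeting \<open>Z\<close> gain in other parts. The
  \<open>Suc\<close> accounts for one extra vertex that forces progress.\<close>

definition cluster_bound :: "nat \<Rightarrow> nat \<Rightarrow> (nat \<Rightarrow> nat) \<Rightarrow> nat" where
  "cluster_bound t \<theta> h =
     reach_bound t \<theta> + h (Suc (reach_bound t \<theta>)) +
     growth t (h (Suc (reach_bound t \<theta>))) * reach_bound t \<theta>"

text \<open>All that the colouring argument uses of bounded treewidth is \<open>separator\<close>.
  The classes of \<open>lab\<close> are unions of components left by \<open>S'\<close>, and
  \<open>\<theta>\<close> bounds the attachments of each class.\<close>

locale separable_graph =
  fixes V0 :: "'v set" and E :: "'v \<Rightarrow> 'v \<Rightarrow> bool" and s t \<theta> :: nat and h :: "nat \<Rightarrow> nat"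
  assumes finite_V0: "finite V0"
    and sym: "E u v \<Longrightarrow> E v u"
    and sparse: "X \<subseteq> V0 \<Longrightarrow> card X = s \<Longrightarrow> card {v \<in> V0 - X. \<forall>x\<in>X. E x v} < t"
    and mono_h: "mono h"
    and separator: "S \<subseteq> V0 \<Longrightarrow> \<exists>S' (lab :: 'v \<Rightarrow> nat). S \<subseteq> S' \<and> S' \<subseteq> V0 \<and> card S' \<le> h (card S) \<and>
      (\<forall>u\<in>V0 - S'. \<forall>v\<in>V0 - S'. E u v \<longrightarrow> lab u = lab v) \<and>
      (\<forall>a. card {u \<in> S'. \<exists>v\<in>V0 - S'. lab v = a \<and> E u v} \<le> \<theta>)"
begin

text \<open>A heavy vertex outside \<open>Y\<close> is adjacent to all of some
  \<open>s\<close>-subset \<open>X\<close> of \<open>Y\<close>, and \<open>sparse\<close> allows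
  fewer than \<open>t\<close> such vertices for each \<open>X\<close>.\<close>

lemma card_heavy_le:
  assumes "Y \<subseteq> V" "V \<subseteq> V0"
  shows "card (heavy E s V Y) \<le> growth t (card Y)"
proof -
  have finY: "finite Y" using assms finite_V0 by (meson finite_subset)
  define Q where "Q X = {v \<in> V0 - X. \<forall>x\<in>X. E x v}" for X
  let ?P = "{X. X \<subseteq> Y \<and> card X = s}"
  have finP: "finite ?P" using finY by simp
  have "heavy E s V Y \<subseteq> Y \<union> (\<Union>X\<in>?P. Q X)"
  proof
    fix v assume v: "v \<in> heavy E s V Y"
    show "v \<in> Y \<union> (\<Union>X\<in>?P. Q X)"
    proof (cases "v \<in> Y")
      case False
      with v have "v \<in> V" "s \<le> card {u \<in> Y. E u v}" by (auto simp: heavy_def)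
      moreover then obtain X where "X \<subseteq> {u \<in> Y. E u v}" "card X = s"
        by (meson obtain_subset_with_card_n)
      ultimately show ?thesis using False assms by (auto simp: Q_def)
    qed auto
  qed
  then have "card (heavy E s V Y) \<le> card (Y \<union> (\<Union>X\<in>?P. Q X))"
    using finY finP finite_V0 by (intro card_mono) (auto simp: Q_def)
  also have "\<dots> \<le> card Y + card (\<Union>X\<in>?P. Q X)" by (rule card_Un_le)
  also have "card (\<Union>X\<in>?P. Q X) \<le> (\<Sum>X\<in>?P. card (Q X))" by (rule card_UN_le[OF finP])
  also have "\<dots> \<le> (\<Sum>X\<in>?P. t)"
  proof (rule sum_mono)
    fix X assume "X \<in> ?P"
    then have "X \<subseteq> V0" "card X = s" using assms by auto
    then show "card (Q X) \<le> t" unfolding Q_def by (rule less_imp_le[OF sparse])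
  qed
  also have "\<dots> = card ?P * t" by simp
  also have "card ?P \<le> card (Pow Y)" using finY by (intro card_mono) auto
  also have "\<dots> = 2 ^ card Y" by (rule card_Pow[OF finY])
  finally show ?thesis by (simp add: growth_def)
qed

lemma card_heavy_iter_le:
  assumes "Y \<subseteq> V" "V \<subseteq> V0" "card Y \<le> n"
  shows "card ((heavy E s V ^^ j) Y) \<le> (growth t ^^ j) n"
proof (induction j)
  case (Suc j)
  have "card (heavy E s V ((heavy E s V ^^ j) Y)) \<le> growth t (card ((heavy E s V ^^ j) Y))"
    using assms by (intro card_heavy_le heavy_iter_subset)
  also have "\<dots> \<le> growth t ((growth t ^^ j) n)" using Suc by (rule growth_mono)
  finally show ?case by simp
qed (use assms in simp)

text \<open>The vertices of \<open>Y\<close> are precoloured. Those of \<open>W\<close> are finished: no uncoloured vertex may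
  reuse the colour of a neighbour in \<open>W\<close>.\<close>

lemma extend_coloring:
  fixes L :: "'v \<Rightarrow> 'c set" and c0 :: "'v \<Rightarrow> 'c"
  assumes lists: "\<And>v. v \<in> V0 \<Longrightarrow> finite (L v) \<Longrightarrow> s + 1 \<le> card (L v)"
  assumes "V \<subseteq> V0" "W \<subseteq> Y" "Y \<subseteq> V" "card Y \<le> \<theta>"
    and "\<And>v. v \<in> V - Y \<Longrightarrow> card {u \<in> W. E u v} < s"
  shows "\<exists>c. (\<forall>y\<in>Y. c y = c0 y) \<and> (\<forall>v\<in>V - Y. c v \<in> L v) \<and>
    (\<forall>v\<in>V - Y. \<forall>u\<in>W. E u v \<longrightarrow> c u \<noteq> c v) \<and>
    (mono_rel E V c)\<^sup>* `` Y \<subseteq> (heavy E s V ^^ \<theta>) Y \<and>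
    (\<forall>v\<in>V. card ((mono_rel E V c)\<^sup>* `` {v}) \<le> cluster_bound t \<theta> h)"
  using assms(2-)
\<comment> \<open>Induction on the number of uncoloured vertices. \<open>W\<close> and
  \<open>c0\<close> vary because a part is entered with its attachments as new \<open>Y\<close> and
  with a new finished set.\<close>
proof (induction "card (V - Y)" arbitrary: V W Y c0 rule: less_induct)
  case less
  note VV0 = \<open>V \<subseteq> V0\<close> and WY = \<open>W \<subseteq> Y\<close> and YV = \<open>Y \<subseteq> V\<close> and cardY = \<open>card Y \<le> \<theta>\<close>
    and Wfew = \<open>\<And>v. v \<in> V - Y \<Longrightarrow> card {u \<in> W. E u v} < s\<close>
  have finV: "finite V" using VV0 finite_V0 finite_subset by blast
  have finY: "finite Y" using YV finV finite_subset by blast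
  define A where "A j = (heavy E s V ^^ j) Y" for j
  have A0: "A 0 = Y" and ASuc: "A (Suc j) = heavy E s V (A j)" for j by (simp_all add: A_def)
  have AV: "A j \<subseteq> V" for j unfolding A_def using YV by (rule heavy_iter_subset)
  have Amono: "i \<le> j \<Longrightarrow> A i \<subseteq> A j" for i j unfolding A_def by (rule heavy_iter_mono)
  have cardA: "card (A \<theta>) \<le> reach_bound t \<theta>"
    unfolding A_def reach_bound_def by (rule card_heavy_iter_le[OF YV VV0 cardY])
  let ?\<eta> = "cluster_bound t \<theta> h"
  show ?case
  proof (cases "V = Y")
    case True
    have "(mono_rel E V c0)\<^sup>* `` X \<subseteq> Y" if "X \<subseteq> Y" for X
      using that mono_rel_reach[of _ _ E V c0] unfolding True by blast
    moreover have "card X \<le> ?\<eta>" if "X \<subseteq> Y" for X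
    proof -
      have "card X \<le> card (A \<theta>)"
        using that Amono[of 0 \<theta>] finite_subset[OF AV finV] unfolding A0
        by (intro card_mono) auto
      then show ?thesis using cardA by (simp add: cluster_bound_def)
    qed
    moreover from calculation(1)[of Y] have "(mono_rel E V c0)\<^sup>* `` Y \<subseteq> A \<theta>"
      using Amono[of 0 \<theta>] unfolding A0 by blast
    ultimately show ?thesis using True unfolding A_def by (intro exI[of _ c0]) simp
  next
    case False
    \<comment> \<open>\<open>v0\<close> goes into the separated set, so that even when
      \<open>A \<theta> = Y\<close> every part has fewer uncoloured vertices than
      \<open>V\<close>.\<close>
    then obtain v0 where v0: "v0 \<in> V" "v0 \<notin> Y" using YV by blast
    \<comment> \<open>Round \<open>j\<close> stops the colour \<open>col j\<close>;
      \<open>\<theta>\<close> rounds suffice because \<open>Y\<close> shows at most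
      \<open>\<theta>\<close> colours.\<close>
    obtain col where col: "c0 ` Y \<subseteq> col ` {1..\<theta>}"
    proof -
      obtain f and n :: nat where fn: "c0 ` Y = f ` {i. i < n}" "inj_on f {i. i < n}"
        using finite_imp_nat_seg_image_inj_on[of "c0 ` Y"] finY by blast
      then have "card (c0 ` Y) = n" by (simp add: card_image)
      with fn have f: "c0 ` Y = f ` {i. i < card (c0 ` Y)}" by simp
      have le: "card (c0 ` Y) \<le> \<theta>" using card_image_le[OF finY] cardY le_trans by blast
      have "c0 ` Y \<subseteq> (\<lambda>j. f (j - 1)) ` {1..\<theta>}"
      proof
        fix x assume "x \<in> c0 ` Y"
        then obtain i where "i < card (c0 ` Y)" "x = f i" using f by auto
        then show "x \<in> (\<lambda>j. f (j - 1)) ` {1..\<theta>}"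
          using le by (intro image_eqI[of _ _ "Suc i"]) auto
      qed
      then show thesis by (rule that)
    qed
    \<comment> \<open>\<open>rk\<close> is the round in which a vertex is coloured;
      \<open>Suc \<theta>\<close> stands for a last round for all vertices outside
      \<open>A \<theta>\<close>.\<close>
    define rk where "rk v = (if v \<in> A \<theta> then LEAST j. v \<in> A j else Suc \<theta>)" for v
    have rk_le: "rk v \<le> j" if "v \<in> A j" "j \<le> \<theta>" for v j
      using that Amono[of j \<theta>] by (auto simp: rk_def intro: Least_le)
    have rk_bound: "rk v \<le> Suc \<theta>" for v
      using rk_le[of v \<theta>] by (cases "v \<in> A \<theta>") (auto simp: rk_def[of v])
    have rk_in: "v \<in> A (rk v)" if "v \<in> A \<theta>" for v
      using that by (auto simp: rk_def intro: LeastI)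
    have rk_pos: "0 < rk v" if "v \<notin> Y" for v
      using that rk_in[of v] A0 by (cases "v \<in> A \<theta>") (auto simp: rk_def[of v] intro: Nat.gr0I)
    \<comment> \<open>The set \<open>Y\<^sub>j\<^sub>-\<^sub>2\<close> whose colours a vertex of round \<open>j\<close> avoids, with \<open>Y\<^sub>-\<^sub>1 = W\<close>.\<close>
    define D where "D j = (if j \<le> 1 then W else A (j - 2))" for j
    have WD: "W \<subseteq> D j" for j using WY Amono[of 0 "j - 2"] A0 by (auto simp: D_def)
    have D_sub: "D j \<subseteq> A \<theta>" if "j \<le> Suc \<theta>" for j
      using that WY Amono[of 0 \<theta>] Amono[of "j - 2" \<theta>] A0 by (auto simp: D_def)
    have finD: "finite (D j)" for j
      using finite_subset[OF AV finV] finite_subset[OF WY finY] by (simp add: D_def)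
    have rk_D: "rk u < rk v" if "u \<in> D (rk v)" "v \<notin> Y" for u v
    proof (cases "rk v \<le> 1")
      case True
      then have "u \<in> A 0" using that WY A0 by (auto simp: D_def)
      then show ?thesis using rk_le[of u 0] rk_pos[OF that(2)] by simp
    next
      case False
      then have "u \<in> A (rk v - 2)" using that by (simp add: D_def)
      then have "rk u \<le> rk v - 2" using rk_bound[of v] by (intro rk_le) auto
      then show ?thesis using False by simp
    qed
    \<comment> \<open>Rank \<open>j\<close> means absence from \<open>A (j - 1)\<close>, hence fewer
      than \<open>s\<close> neighbours in \<open>A (j - 2)\<close>; in round 1 the hypothesis on
      \<open>W\<close> applies.\<close>
    have D_few: "card {u \<in> D (rk v). E u v} < s" if "v \<in> V - Y" for v
    proof (cases "rk v \<le> 1")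
      case True
      then show ?thesis using Wfew[OF that] by (simp add: D_def)
    next
      case False
      let ?j = "rk v - 2"
      have "v \<notin> A (Suc ?j)"
      proof
        assume "v \<in> A (Suc ?j)"
        then have "rk v \<le> Suc ?j" using rk_bound[of v] False by (intro rk_le) auto
        then show False using False by simp
      qed
      then show ?thesis using that False by (simp add: ASuc heavy_def D_def)
    qed
    \<comment> \<open>A greedy colouring by recursion on \<open>rk\<close>: by \<open>rk_D\<close>
      the constraints on \<open>v\<close> refer only to vertices of smaller rank.\<close>
    define P where "P f v r \<longleftrightarrow> (if v \<in> Y then r = c0 v else
      v \<in> V \<longrightarrow> r \<in> L v \<and> r \<noteq> col (rk v) \<and> (\<forall>u\<in>D (rk v). E u v \<longrightarrow> f u \<noteq> r))" for f v r
    have "\<exists>f. \<forall>v. P f v (f v)"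
    proof (rule dependent_wf_choice[of "measure rk"])
      fix f g :: "'v \<Rightarrow> 'c" and v r
      assume "\<And>z. (z, v) \<in> measure rk \<Longrightarrow> f z = g z"
      then show "P f v r = P g v r" using rk_D by (auto simp: P_def)
    next
      fix v and f :: "'v \<Rightarrow> 'c"
      show "\<exists>r. P f v r"
      proof (cases "v \<in> V - Y")
        case True
        let ?N = "{u \<in> D (rk v). E u v}"
        let ?B = "insert (col (rk v)) (f ` ?N)"
        have finN: "finite ?N" using finD by simp
        \<comment> \<open>At most \<open>s - 1\<close> neighbours in \<open>D (rk v)\<close> and the
          one colour \<open>col (rk v)\<close> are forbidden.\<close>
        have cardB: "card ?B \<le> s"
          using card_insert_le_m1[of s "f ` ?N" "col (rk v)"] card_image_le[OF finN, of f]
            D_few[OF True] by linarith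
        have "\<not> L v \<subseteq> ?B"
        proof
          assume sub: "L v \<subseteq> ?B"
          then have "finite (L v)" using finN by (auto intro: finite_subset)
          moreover from sub have "card (L v) \<le> s"
            using cardB card_mono[OF _ sub] finN by auto
          ultimately show False using lists[of v] True VV0 by auto
        qed
        then obtain r where "r \<in> L v" "r \<notin> ?B" by blast
        then show ?thesis using True by (intro exI[of _ r]) (auto simp: P_def)
      qed (auto simp: P_def)
    qed simp
    \<comment> \<open>\<open>c1\<close> is kept on \<open>Z\<close> only; the induction hypothesis
      recolours the rest.\<close>
    then obtain c1 where c1: "\<And>v. P c1 v (c1 v)" by blast
    have c1_Y: "c1 y = c0 y" if "y \<in> Y" for y using c1[of y] that by (simp add: P_def)
    have c1_L: "c1 v \<in> L v" and c1_col: "c1 v \<noteq> col (rk v)"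
      and c1_D: "\<And>u. u \<in> D (rk v) \<Longrightarrow> E u v \<Longrightarrow> c1 u \<noteq> c1 v" if "v \<in> V - Y" for v
      using c1[of v] that by (auto simp: P_def)

    define S where "S = insert v0 (A \<theta>)"
    have SV: "S \<subseteq> V" using AV v0 by (auto simp: S_def)
    obtain S' and lab :: "'v \<Rightarrow> nat" where S': "S \<subseteq> S'" "S' \<subseteq> V0" "card S' \<le> h (card S)"
      and lab: "\<And>u v. u \<in> V0 - S' \<Longrightarrow> v \<in> V0 - S' \<Longrightarrow> E u v \<Longrightarrow> lab u = lab v"
      and attach: "\<And>a. card {u \<in> S'. \<exists>v\<in>V0 - S'. lab v = a \<and> E u v} \<le> \<theta>"
      using separator[of S] SV VV0 by blast
    have finS': "finite S'" using S' finite_V0 finite_subset by blast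
    \<comment> \<open>The separator is taken in the whole graph \<open>V0\<close>; intersecting it
      with the current \<open>V\<close> keeps both size bounds.\<close>
    define Z where "Z = S' \<inter> V"
    have SZ: "S \<subseteq> Z" using S' SV by (auto simp: Z_def)
    have AZ: "A j \<subseteq> Z" if "j \<le> \<theta>" for j using Amono[OF that] SZ by (auto simp: S_def)
    have YZ: "Y \<subseteq> Z" using AZ[of 0] A0 by simp
    have ZV: "Z \<subseteq> V" by (simp add: Z_def)
    have finZ: "finite Z" using ZV finV finite_subset by blast
    have cardZ: "card Z \<le> h (Suc (reach_bound t \<theta>))"
    proof -
      have "card Z \<le> card S'" using finS' by (auto simp: Z_def intro: card_mono)
      also have "card S' \<le> h (card S)" by (rule S')
      also have "h (card S) \<le> h (Suc (reach_bound t \<theta>))"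
        using cardA card_insert_le_m1[of "Suc (reach_bound t \<theta>)" "A \<theta>" v0]
        by (intro monoD[OF mono_h]) (simp add: S_def)
      finally show ?thesis .
    qed
    define C where "C a = {v \<in> V - Z. lab v = a}" for a
    define Ya where "Ya a = {u \<in> Z. \<exists>v\<in>C a. E u v}" for a
    define Va where "Va a = C a \<union> Ya a" for a
    \<comment> \<open>Vertices of \<open>C a\<close> all have rank \<open>Suc \<theta>\<close>, so
      the constraint from \<open>D (Suc \<theta>)\<close> is handed to the recursive call as its
      finished set.\<close>
    define Wa where "Wa a = Ya a \<inter> D (Suc \<theta>)" for a
    have C_diff: "Va a - Ya a = C a" for a by (auto simp: Va_def Ya_def C_def)
    have VaV: "Va a \<subseteq> V" for a using ZV by (auto simp: Va_def Ya_def C_def)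
    have rk_C: "rk v = Suc \<theta>" if "v \<in> C a" for v a
      using that AZ[of \<theta>] by (auto simp: C_def rk_def)
    have C_VY: "C a \<subseteq> V - Y" for a using YZ by (auto simp: C_def)
    have edge_cases: "u \<in> Z \<and> u \<in> Ya a \<or> u \<in> C a" if "v \<in> C a" "u \<in> V" "E u v" for u v a
      using that lab[of u v] VV0 by (auto simp: C_def Ya_def Z_def)
    define IHc where "IHc a c \<longleftrightarrow> (\<forall>y\<in>Ya a. c y = c1 y) \<and> (\<forall>v\<in>C a. c v \<in> L v) \<and>
      (\<forall>v\<in>C a. \<forall>u\<in>Wa a. E u v \<longrightarrow> c u \<noteq> c v) \<and>
      (mono_rel E (Va a) c)\<^sup>* `` Ya a \<subseteq> (heavy E s (Va a) ^^ \<theta>) (Ya a) \<and>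
      (\<forall>v\<in>Va a. card ((mono_rel E (Va a) c)\<^sup>* `` {v}) \<le> ?\<eta>)" for a c
    have Ya_card: "card (Ya a) \<le> \<theta>" for a
    proof -
      have "Ya a \<subseteq> {u \<in> S'. \<exists>v\<in>V0 - S'. lab v = a \<and> E u v}"
        using VV0 by (auto simp: Ya_def C_def Z_def)
      then have "card (Ya a) \<le> card {u \<in> S'. \<exists>v\<in>V0 - S'. lab v = a \<and> E u v}"
        using finS' by (intro card_mono) auto
      then show ?thesis using attach[of a] by (rule le_trans)
    qed
    have "\<exists>c. IHc a c" for a
    proof -
      have "C a \<subset> V - Y" using C_VY[of a] v0 SZ by (auto simp: C_def S_def)
      then have "card (Va a - Ya a) < card (V - Y)"
        unfolding C_diff using finV by (intro psubset_card_mono) auto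
      then have "\<exists>c. (\<forall>y\<in>Ya a. c y = c1 y) \<and> (\<forall>v\<in>Va a - Ya a. c v \<in> L v) \<and>
          (\<forall>v\<in>Va a - Ya a. \<forall>u\<in>Wa a. E u v \<longrightarrow> c u \<noteq> c v) \<and>
          (mono_rel E (Va a) c)\<^sup>* `` Ya a \<subseteq> (heavy E s (Va a) ^^ \<theta>) (Ya a) \<and>
          (\<forall>v\<in>Va a. card ((mono_rel E (Va a) c)\<^sup>* `` {v}) \<le> ?\<eta>)"
      proof (rule less.hyps)
        show "Va a \<subseteq> V0" using VaV VV0 by blast
        show "Wa a \<subseteq> Ya a" "Ya a \<subseteq> Va a" by (auto simp: Wa_def Va_def)
        show "card (Ya a) \<le> \<theta>" by (rule Ya_card)
        fix v assume "v \<in> Va a - Ya a"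
        then have v: "v \<in> C a" by (simp add: C_diff)
        have "card {u \<in> Wa a. E u v} \<le> card {u \<in> D (rk v). E u v}"
          using finD by (intro card_mono) (auto simp: Wa_def rk_C[OF v])
        also have "\<dots> < s" using D_few v C_VY by blast
        finally show "card {u \<in> Wa a. E u v} < s" .
      qed
      then show ?thesis by (simp add: IHc_def C_diff)
    qed
    then obtain cs where cs: "\<And>a. IHc a (cs a)" by metis
    define c where "c v = (if v \<in> Z then c1 v else cs (lab v) v)" for v
    have c_Va: "c v = cs a v" if "v \<in> Va a" for v a
      using that cs[of a] by (auto simp: c_def Va_def C_def Ya_def IHc_def)
    define R where "R = mono_rel E V c"
    define Ra where "Ra a = mono_rel E (Va a) c" for a
    have Ra_cs: "Ra a = mono_rel E (Va a) (cs a)" for a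
      using c_Va by (auto simp: Ra_def mono_rel_def)
    have Ra_reach: "(Ra a)\<^sup>* `` Ya a \<subseteq> (heavy E s (Va a) ^^ \<theta>) (Ya a)"
      and Ra_card: "\<And>v. v \<in> Va a \<Longrightarrow> card ((Ra a)\<^sup>* `` {v}) \<le> ?\<eta>" for a
      using cs[of a] by (auto simp: Ra_cs IHc_def)
    have cZ: "c v = c1 v" if "v \<in> Z" for v using that by (simp add: c_def)
    have c_L: "c v \<in> L v" if "v \<in> V - Y" for v
    proof (cases "v \<in> Z")
      case False
      then have "v \<in> C (lab v)" using that by (simp add: C_def)
      then show ?thesis using cs[of "lab v"] False by (simp add: c_def IHc_def)
    qed (use c1_L that cZ in simp)
    have c_D: "c u \<noteq> c v" if v: "v \<in> V - Y" and u: "u \<in> D (rk v)" "E u v" for u v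
    proof (cases "v \<in> Z")
      case True
      have "u \<in> Z" using u D_sub[OF rk_bound] AZ[of \<theta>] by blast
      then show ?thesis using True c1_D[OF v u] by (simp add: cZ)
    next
      case False
      define a where "a = lab v"
      have vC: "v \<in> C a" using v False by (simp add: C_def a_def)
      have uD: "u \<in> D (Suc \<theta>)" using u rk_C[OF vC] by simp
      then have "u \<in> Z" using D_sub[of "Suc \<theta>"] AZ[of \<theta>] by blast
      then have "u \<in> Ya a" using vC u by (auto simp: Ya_def)
      then have "u \<in> Wa a" using uD by (simp add: Wa_def)
      then have "cs a u \<noteq> cs a v" using cs[of a] vC u by (simp add: IHc_def)
      then show ?thesis using c_Va[of u a] c_Va[of v a] \<open>u \<in> Ya a\<close> vC
        by (simp add: Va_def)
    qed
    have reach_Y: "R\<^sup>* `` {y} \<subseteq> A \<theta>" if y: "y \<in> Y" for y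
    proof -
      obtain k where k: "k \<in> {1..\<theta>}" "c0 y = col k" using col y by blast
      \<comment> \<open>A vertex outside \<open>A (k - 1)\<close> has rank at least
        \<open>k\<close>. Rank \<open>k\<close> excludes the colour \<open>col k\<close> itself, and
        a higher rank excludes the colours of neighbours in \<open>A (k - 1)\<close>. So the cluster
        cannot leave \<open>A (k - 1)\<close>.\<close>
      have "v \<in> A (k - 1) \<and> c v = col k" if "(y, v) \<in> R\<^sup>*" for v
        using that
      proof (induction rule: rtrancl_induct)
        case base
        show ?case using y Amono[of 0 "k - 1"] k c1_Y cZ YZ by (auto simp: A0)
      next
        case (step v v')
        then have v': "v' \<in> V" "E v v'" "c v' = col k" "c v' = c v"
          by (auto simp: R_def mono_rel_def)
        have "v' \<in> A (k - 1)"
        proof (rule ccontr)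
          assume n: "v' \<notin> A (k - 1)"
          then have v'Y: "v' \<notin> Y" using Amono[of 0 "k - 1"] A0 by auto
          have "k \<le> rk v'"
          proof (rule ccontr)
            assume "\<not> k \<le> rk v'"
            then have "rk v' \<le> k - 1" "v' \<in> A \<theta>" using k by (auto simp: rk_def split: if_splits)
            then show False using n rk_in Amono[of "rk v'" "k - 1"] by blast
          qed
          show False
          proof (cases "rk v' = k")
            case True
            then have "v' \<in> A \<theta>" using k by (auto simp: rk_def split: if_splits)
            then show False using c1_col[of v'] v' v'Y True AZ[of \<theta>] cZ by auto
          next
            case False
            then have "Suc k \<le> rk v'" using \<open>k \<le> rk v'\<close> by simp
            then have "A (k - 1) \<subseteq> D (rk v')" using k Amono[of "k - 1" "rk v' - 2"] 
              by (auto simp: D_def)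
            then show False using c_D[of v' v] v' v'Y step by auto
          qed
        qed
        then show ?case using v' by simp
      qed
      moreover have "A (k - 1) \<subseteq> A \<theta>" using k by (intro Amono) auto
      ultimately show ?thesis by blast
    qed
    \<comment> \<open>A path passes between parts only through \<open>Z\<close>, so \<open>U\<close>
      is closed under \<open>R\<close> and contains every cluster that meets
      \<open>Z\<close>.\<close>
    define U where "U = Z \<union> (\<Union>a\<in>lab ` (V - Z). (Ra a)\<^sup>* `` Ya a)"
    have U_closed: "x' \<in> U" if x: "x \<in> U" "(x, x') \<in> R" for x x'
    proof (cases "x' \<in> Z")
      case False
      define a where "a = lab x'"
      have x': "x' \<in> C a" "x \<in> V" "E x x'" "c x = c x'" "x' \<in> V"
        using x False by (auto simp: R_def mono_rel_def C_def a_def)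
      have a: "a \<in> lab ` (V - Z)" using x' False by (auto simp: a_def)
      have xY: "x \<in> (Ra a)\<^sup>* `` Ya a"
      proof (cases "x \<in> Z")
        case True
        then show ?thesis using x' edge_cases[of x' a x] by (auto simp: C_def)
      next
        case False
        then have xC: "x \<in> C a" using edge_cases[of x' a x] x' by auto
        obtain b where b: "x \<in> (Ra b)\<^sup>* `` Ya b" using x False by (auto simp: U_def)
        then have "x \<in> Va b" using mono_rel_reach[of _ x E "Va b" c]
          by (auto simp: Ra_def Va_def)
        then have "b = a" using xC False by (auto simp: Va_def C_def Ya_def)
        then show ?thesis using b by simp
      qed
      have "x \<in> Va a" using edge_cases[of x' a x] x' by (auto simp: Va_def)
      then have "(x, x') \<in> Ra a" using x' by (auto simp: Ra_def mono_rel_def Va_def)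
      then have "x' \<in> (Ra a)\<^sup>* `` Ya a" using xY by (auto intro: rtrancl_into_rtrancl)
      then show ?thesis using a by (auto simp: U_def)
    qed (simp add: U_def)
    \<comment> \<open>In a part outside \<open>Act\<close> the heavy iteration is constant, so
      clusters entering it from \<open>Z\<close> gain nothing beyond \<open>Ya a\<close>.\<close>
    define Act where "Act = {a \<in> lab ` (V - Z). \<not> heavy E s (Va a) (Ya a) \<subseteq> Ya a}"
    have finAct: "finite Act" using finV by (simp add: Act_def)
    \<comment> \<open>A vertex of \<open>C a\<close> that is heavy for \<open>Ya a\<close> is heavy
      for \<open>Z\<close> too, and its label is \<open>a\<close>; so the number of active parts is
      bounded by \<open>heavy E s V Z\<close>.\<close>
    have Act_sub: "Act \<subseteq> lab ` heavy E s V Z"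
    proof
      fix a assume "a \<in> Act"
      then obtain v where v: "v \<in> Va a" "v \<notin> Ya a" "s \<le> card {u \<in> Ya a. E u v}"
        by (auto simp: Act_def heavy_def)
      then have vC: "v \<in> C a" by (auto simp: Va_def)
      have "card {u \<in> Ya a. E u v} \<le> card {u \<in> Z. E u v}"
        using finZ by (intro card_mono) (auto simp: Ya_def)
      then have "v \<in> heavy E s V Z" using v vC by (auto simp: heavy_def C_def)
      then show "a \<in> lab ` heavy E s V Z" using vC by (auto simp: C_def)
    qed
    have cardAct: "card Act \<le> growth t (h (Suc (reach_bound t \<theta>)))"
    proof -
      have fin: "finite (heavy E s V Z)" using heavy_subset[OF ZV] finV finite_subset by blast
      have "card Act \<le> card (lab ` heavy E s V Z)" using Act_sub fin by (intro card_mono) auto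
      also have "\<dots> \<le> card (heavy E s V Z)" by (rule card_image_le[OF fin])
      also have "\<dots> \<le> growth t (card Z)" by (rule card_heavy_le[OF ZV VV0])
      also have "\<dots> \<le> growth t (h (Suc (reach_bound t \<theta>)))" by (rule growth_mono[OF cardZ])
      finally show ?thesis .
    qed
    define T where "T a = (heavy E s (Va a) ^^ \<theta>) (Ya a)" for a
    have TV: "T a \<subseteq> V" for a
      using heavy_iter_subset[of "Ya a" "Va a"] VaV[of a] by (force simp: T_def Va_def)
    have cardT: "card (T a) \<le> reach_bound t \<theta>" for a
      unfolding T_def reach_bound_def using VaV VV0 Ya_card[of a]
      by (intro card_heavy_iter_le) (auto simp: Va_def)
    have "U \<subseteq> Z \<union> (\<Union>a\<in>Act. T a)"
    proof
      fix x assume "x \<in> U"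
      then consider "x \<in> Z" | a where "a \<in> lab ` (V - Z)" "x \<in> T a"
        using Ra_reach by (auto simp: U_def T_def)
      then show "x \<in> Z \<union> (\<Union>a\<in>Act. T a)"
      proof cases
        case (2 a)
        show ?thesis
        proof (cases "a \<in> Act")
          case False
          then have "heavy E s (Va a) (Ya a) \<subseteq> Ya a" using 2 by (simp add: Act_def)
          then have "T a = Ya a" unfolding T_def by (rule heavy_iter_fixed)
          then show ?thesis using 2 by (auto simp: Ya_def)
        qed (use 2 in auto)
      qed simp
    qed
    then have "card U \<le> card (Z \<union> (\<Union>a\<in>Act. T a))"
      using finZ finAct TV finV by (intro card_mono) (auto intro: finite_subset)
    also have "\<dots> \<le> card Z + card (\<Union>a\<in>Act. T a)" by (rule card_Un_le)
    also have "card (\<Union>a\<in>Act. T a) \<le> (\<Sum>a\<in>Act. card (T a))" by (rule card_UN_le[OF finAct])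
    also have "\<dots> \<le> card Act * reach_bound t \<theta>"
      using sum_bounded_above[of Act "\<lambda>a. card (T a)"] cardT by simp
    also have "\<dots> \<le> growth t (h (Suc (reach_bound t \<theta>))) * reach_bound t \<theta>"
      using cardAct by (rule mult_le_mono1)
    finally have cardU: "card U \<le> ?\<eta>" using cardZ by (simp add: cluster_bound_def)
    have finT: "finite (T a)" for a using TV finV by (rule finite_subset)
    have finU: "finite U"
      by (rule finite_subset[OF \<open>U \<subseteq> Z \<union> (\<Union>a\<in>Act. T a)\<close>]) (use finZ finAct finT in simp)
    have Rsym: "(x, y) \<in> R\<^sup>* \<Longrightarrow> (y, x) \<in> R\<^sup>*" for x y
      by (rule symD[OF sym_rtrancl]) (auto simp: R_def mono_rel_def sym_def intro: sym)
    \<comment> \<open>A cluster that meets \<open>Z\<close> lies in \<open>U\<close>; any other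
      stays inside one part, where the induction hypothesis bounds it.\<close>
    have cluster: "card (R\<^sup>* `` {v}) \<le> ?\<eta>" if v: "v \<in> V" for v
    proof (cases "R\<^sup>* `` {v} \<inter> Z = {}")
      case False
      then obtain z where z: "z \<in> Z" "(v, z) \<in> R\<^sup>*" by auto
      have "x \<in> U" if "(z, x) \<in> R\<^sup>*" for x
        using that by (induction rule: rtrancl_induct) (use z U_closed in \<open>auto simp: U_def\<close>)
      then have "R\<^sup>* `` {v} \<subseteq> U" using Rsym[OF z(2)] by (auto intro: rtrancl_trans)
      then show ?thesis using card_mono[OF finU] cardU le_trans by blast
    next
      case True
      define a where "a = lab v"
      have vC: "v \<in> C a" using True v by (auto simp: C_def a_def)
      have "x \<in> C a \<and> (v, x) \<in> (Ra a)\<^sup>*" if "(v, x) \<in> R\<^sup>*" for x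
        using that
      proof (induction rule: rtrancl_induct)
        case (step x x')
        have "x' \<notin> Z" using True step by (auto intro: rtrancl_into_rtrancl)
        then have "x' \<in> C a"
          using edge_cases[of x a x'] step sym[of x x'] by (auto simp: R_def mono_rel_def)
        then have "(x, x') \<in> Ra a" using step by (auto simp: R_def Ra_def mono_rel_def Va_def)
        then show ?case using step \<open>x' \<in> C a\<close> by (auto intro: rtrancl_into_rtrancl)
      qed (use vC in simp)
      then have "R\<^sup>* `` {v} \<subseteq> (Ra a)\<^sup>* `` {v}" by auto
      moreover have "finite ((Ra a)\<^sup>* `` {v})"
        using vC VaV[of a] finV mono_rel_reach[of v _ E "Va a" c]
        by (auto simp: Ra_def Va_def intro!: finite_subset[of _ V])
      ultimately have "card (R\<^sup>* `` {v}) \<le> card ((Ra a)\<^sup>* `` {v})" by (rule card_mono[rotated])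
      also have "\<dots> \<le> ?\<eta>" using Ra_card[of v a] vC by (simp add: Va_def)
      finally show ?thesis .
    qed
    show ?thesis
    proof (intro exI[of _ c] conjI ballI impI)
      show "c y = c0 y" if "y \<in> Y" for y using that YZ cZ c1_Y by auto
      show "c u \<noteq> c v" if "v \<in> V - Y" "u \<in> W" "E u v" for u v
        using that c_D WD by blast
      show "(mono_rel E V c)\<^sup>* `` Y \<subseteq> (heavy E s V ^^ \<theta>) Y"
        using reach_Y unfolding R_def A_def by blast
    qed (use c_L cluster R_def in auto)
  qed
qed

end

section \<open>Separators from rooted tree decompositions\<close>

text \<open>The tree has nodes \<open>0, ..., n - 1\<close>, root \<open>0\<close> and
  smaller-numbered parents. \<open>running\<close> replaces connectivity of the set of nodes whose
  bags contain \<open>v\<close>.\<close>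

locale rooted_bags =
  fixes n :: nat and p :: "nat \<Rightarrow> nat" and B :: "nat \<Rightarrow> 'v set" and k :: nat
  assumes parent: "0 < i \<Longrightarrow> i < n \<Longrightarrow> p i < i"
    and running: "i < n \<Longrightarrow> v \<in> B i \<Longrightarrow> j < i \<Longrightarrow> v \<in> B j \<Longrightarrow> v \<in> B (p i)"
    and finite_bag: "i < n \<Longrightarrow> finite (B i)"
    and card_bag: "i < n \<Longrightarrow> card (B i) \<le> k"
begin

section \<open>The ancestor order and lowest common ancestors\<close>

definition anc :: "nat \<Rightarrow> nat \<Rightarrow> bool" (infix "\<preceq>" 50) where
  "x \<preceq> y \<longleftrightarrow> (x, y) \<in> {(p i, i) | i. 0 < i \<and> i < n}\<^sup>*"

definition top_node :: "'v \<Rightarrow> nat" where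
  "top_node v = (LEAST i. v \<in> B i)"

lemma anc_refl: "x \<preceq> x" by (simp add: anc_def)

lemma anc_trans: "x \<preceq> y \<Longrightarrow> y \<preceq> z \<Longrightarrow> x \<preceq> z"
  unfolding anc_def by (rule rtrancl_trans)

lemma anc_le: "x \<preceq> y \<Longrightarrow> x \<le> y"
  unfolding anc_def by (induction rule: rtrancl_induct) (auto dest: parent)

text \<open>Parents are unique, so both nodes lie on the one upward path from
  \<open>z\<close>.\<close>

lemma anc_linear:
  assumes "x \<preceq> z" "y \<preceq> z" shows "x \<preceq> y \<or> y \<preceq> x"
proof -
  have "single_valued ({(p i, i) | i. 0 < i \<and> i < n}\<inverse>)" by (auto simp: single_valued_def)
  from single_valued_confluent[OF this] assms show ?thesis
    by (auto simp: anc_def rtrancl_converse)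
qed

lemma anc_of_le: "x \<preceq> z \<Longrightarrow> y \<preceq> z \<Longrightarrow> x \<le> y \<Longrightarrow> x \<preceq> y"
  using anc_linear[of x z y] anc_le[of y x] anc_refl by fastforce

lemma root_anc: "i < n \<Longrightarrow> 0 \<preceq> i"
proof (induction i rule: less_induct)
  case (less i)
  show ?case
  proof (cases "i = 0")
    case False
    then have "0 \<preceq> p i" using parent less by auto
    moreover have "p i \<preceq> i" using False less by (auto simp: anc_def)
    ultimately show ?thesis by (rule anc_trans)
  qed (simp add: anc_refl)
qed

text \<open>The ancestors of \<open>a\<close> form a chain ordered like their indices, so the common
  ancestor with the largest index is the lowest; the root is always common.\<close>

lemma lca_exists:
  assumes "a < n" "b < n"
  shows "\<exists>x. x \<preceq> a \<and> x \<preceq> b \<and> (\<forall>y. y \<preceq> a \<longrightarrow> y \<preceq> b \<longrightarrow> y \<preceq> x)"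
proof -
  let ?X = "{x. x \<preceq> a \<and> x \<preceq> b}"
  have fin: "finite ?X" by (rule finite_subset[of _ "{..a}"]) (auto dest: anc_le)
  have "0 \<in> ?X" using assms root_anc by simp
  then have "Max ?X \<in> ?X" using fin by (intro Max_in) auto
  then show ?thesis using Max_ge[OF fin] anc_of_le[of _ a "Max ?X"] by auto
qed

lemma top_node_in: "v \<in> B i \<Longrightarrow> v \<in> B (top_node v)"
  unfolding top_node_def by (rule LeastI)

lemma top_node_le: "v \<in> B i \<Longrightarrow> top_node v \<le> i"
  unfolding top_node_def by (rule Least_le)

text \<open>On the way up from \<open>i\<close>, \<open>running\<close> keeps \<open>v\<close> in
  the bag as long as the index exceeds \<open>top_node v\<close>, so the walk arrives there.\<close>

lemma top_node_anc: "i < n \<Longrightarrow> v \<in> B i \<Longrightarrow> top_node v \<preceq> i"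
proof (induction i rule: less_induct)
  case (less i)
  show ?case
  proof (cases "i = top_node v")
    case False
    then have lt: "top_node v < i" using top_node_le[of v i] less by simp
    then have "v \<in> B (p i)" using running[of i v "top_node v"] top_node_in less by blast
    then have "top_node v \<preceq> p i" using less parent[of i] lt by auto
    moreover have "p i \<preceq> i" using lt less by (auto simp: anc_def)
    ultimately show ?thesis by (rule anc_trans)
  qed (simp add: anc_refl)
qed

text \<open>The same upward walk, stopped at \<open>x\<close>: all nodes passed have index at least
  \<open>top_node v\<close>.\<close>

lemma bag_between: "x \<preceq> i \<Longrightarrow> v \<in> B i \<Longrightarrow> top_node v \<le> x \<Longrightarrow> v \<in> B x"
proof (unfold anc_def, induction rule: rtrancl_induct)
  case (step j i)
  then have i: "0 < i" "i < n" "j = p i" by auto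
  have "x \<le> j" using step anc_le by (simp add: anc_def)
  then have "v \<in> B j"
    using running[of i v "top_node v"] top_node_in step i parent[of i] by auto
  then show ?case using step by simp
qed

text \<open>\<open>S'\<close> consists of the bags at the lowest common ancestors of the top nodes of \<open>S\<close>. Deleting
  these nodes cuts the tree into regions, and below the root of a region there is at most one
  topmost deleted node; so a region attaches to at most two bags. The label of a vertex is the
  root of its region.\<close>

lemma separator_exists:
  fixes E :: "'v \<Rightarrow> 'v \<Rightarrow> bool"
  assumes cover: "\<And>v. v \<in> V \<Longrightarrow> \<exists>i<n. v \<in> B i" and bags: "\<And>i. i < n \<Longrightarrow> B i \<subseteq> V"
    and edge: "\<And>u v. u \<in> V \<Longrightarrow> v \<in> V \<Longrightarrow> E u v \<Longrightarrow> \<exists>i<n. u \<in> B i \<and> v \<in> B i"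
    and SV: "S \<subseteq> V" and finS: "finite S"
  shows "\<exists>S' (lab :: 'v \<Rightarrow> nat). S \<subseteq> S' \<and> S' \<subseteq> V \<and> card S' \<le> card S * card S * k \<and>
      (\<forall>u\<in>V - S'. \<forall>v\<in>V - S'. E u v \<longrightarrow> lab u = lab v) \<and>
      (\<forall>a. card {u \<in> S'. \<exists>v\<in>V - S'. lab v = a \<and> E u v} \<le> 2 * k)"
proof -
  obtain lca where lca: "\<And>a b. a < n \<Longrightarrow> b < n \<Longrightarrow> lca a b \<preceq> a"
      "\<And>a b. a < n \<Longrightarrow> b < n \<Longrightarrow> lca a b \<preceq> b"
      "\<And>a b y. a < n \<Longrightarrow> b < n \<Longrightarrow> y \<preceq> a \<Longrightarrow> y \<preceq> b \<Longrightarrow> y \<preceq> lca a b"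
    using lca_exists by metis
  have top_n: "top_node v < n" and top_in: "v \<in> B (top_node v)" if "v \<in> V" for v
    using cover[OF that] top_node_le top_node_in by (blast intro: le_less_trans)+
  define M where "M = top_node ` S"
  \<comment> \<open>One round of pairwise common ancestors is enough to make the topmost deleted
    node below a region root unique, see \<open>m_anc\<close>.\<close>
  define M' where "M' = (\<lambda>(a, b). lca a b) ` (M \<times> M)"
  define S' where "S' = (\<Union>i\<in>M'. B i)"
  have M_n: "a < n" if "a \<in> M" for a using that top_n SV by (auto simp: M_def)
  have M'_n: "m < n" if "m \<in> M'" for m
  proof -
    obtain a b where ab: "a \<in> M" "b \<in> M" "m = lca a b" using \<open>m \<in> M'\<close> by (auto simp: M'_def)
    then have "m \<le> a" using lca(1) M_n anc_le by blast
    then show ?thesis using M_n[OF ab(1)] by simp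
  qed
  have finM: "finite M" "finite M'" using finS by (auto simp: M_def M'_def)
  have "M \<subseteq> M'"
  proof
    fix a assume a: "a \<in> M"
    have "a \<le> lca a a" "lca a a \<le> a" using lca M_n[OF a] anc_le anc_refl by blast+
    then have "a = lca a a" by simp
    then show "a \<in> M'" using a by (force simp: M'_def)
  qed
  then have "S \<subseteq> S'" using top_in SV by (force simp: S'_def M_def)
  moreover have "S' \<subseteq> V" using bags M'_n by (auto simp: S'_def)
  moreover have "card S' \<le> card S * card S * k"
  proof -
    have "card M \<le> card S" unfolding M_def by (rule card_image_le[OF finS])
    have "card M' \<le> card (M \<times> M)" unfolding M'_def using finM by (intro card_image_le) auto
    also have "\<dots> \<le> card S * card S"
      using \<open>card M \<le> card S\<close> by (simp add: card_cartesian_product mult_le_mono)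
    finally have "card M' * k \<le> card S * card S * k" by (rule mult_le_mono1)
    moreover have "card S' \<le> (\<Sum>i\<in>M'. card (B i))"
      unfolding S'_def by (rule card_UN_le[OF finM(2)])
    moreover have "\<dots> \<le> card M' * k"
      using sum_bounded_above[of M' "\<lambda>i. card (B i)" k] card_bag M'_n by simp
    ultimately show ?thesis by linarith
  qed
  \<comment> \<open>Both ends count, so \<open>clear x x\<close> says that \<open>x\<close> itself
    is not deleted.\<close>
  moreover define clear where "clear x z \<longleftrightarrow> (\<forall>y. x \<preceq> y \<longrightarrow> y \<preceq> z \<longrightarrow> y \<notin> M')" for x z
  have clear_bag: "clear (top_node v) i" if "v \<notin> S'" "v \<in> B i" for v i
    using that bag_between anc_le by (auto simp: clear_def S'_def)
  have clear_join: "clear x z" if "clear x y" "clear y z" "y \<preceq> z" for x y z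
    using that anc_linear[of y z] by (metis clear_def)
  \<comment> \<open>Indices decrease upwards, so \<open>LEAST\<close> picks the topmost node with a
    clear path down to \<open>top_node v\<close>.\<close>
  define lab where "lab v = (LEAST x. x \<preceq> top_node v \<and> clear x (top_node v))" for v
  have lab: "lab v \<preceq> top_node v" "clear (lab v) (top_node v)" if "v \<in> V - S'" for v
    using LeastI[of "\<lambda>x. x \<preceq> top_node v \<and> clear x (top_node v)" "top_node v"]
      anc_refl clear_bag[of v "top_node v"] top_in that by (auto simp: lab_def)
  have lab_le: "lab v \<le> x" if "x \<preceq> top_node v" "clear x (top_node v)" for x v
    unfolding lab_def using that by (intro Least_le) simp
  \<comment> \<open>Both top nodes lie above the common bag \<open>i\<close>, hence are comparable,
    and the path between them is clear because all its bags contain \<open>u\<close>.\<close>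
  have lab_eq: "lab u = lab v" if u: "u \<in> V - S'" and v: "v \<in> V - S'"
    and uv: "u \<in> B i" "v \<in> B i" "i < n" "top_node u \<le> top_node v" for u v i
  proof (rule antisym)
    have tuv: "top_node u \<preceq> top_node v"
      using anc_of_le[of "top_node u" i "top_node v"] top_node_anc uv by blast
    have "clear (top_node u) (top_node v)"
      using clear_bag[of u i] u uv top_node_anc[of i v] anc_trans by (auto simp: clear_def)
    then have "clear (lab u) (top_node v)" using clear_join lab[OF u] tuv by blast
    then show le: "lab v \<le> lab u" using lab_le lab[OF u] tuv anc_trans by blast
    have "lab v \<preceq> lab u"
      using anc_of_le[OF _ _ le] lab[OF v] lab[OF u] tuv anc_trans by blast
    moreover have "clear (lab v) (top_node u)"
      using lab[OF v] tuv anc_trans by (auto simp: clear_def)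
    ultimately show "lab u \<le> lab v" using lab_le lab[OF u] anc_trans by blast
  qed
  have "\<forall>u\<in>V - S'. \<forall>v\<in>V - S'. E u v \<longrightarrow> lab u = lab v"
  proof (intro ballI impI)
    fix u v assume uv: "u \<in> V - S'" "v \<in> V - S'" "E u v"
    then obtain i where "i < n" "u \<in> B i" "v \<in> B i" using edge by blast
    then show "lab u = lab v"
      using lab_eq[OF uv(1,2)] lab_eq[OF uv(2,1)] by (metis linear)
  qed
  moreover have "\<forall>a. card {u \<in> S'. \<exists>v\<in>V - S'. lab v = a \<and> E u v} \<le> 2 * k"
  proof
    fix a
    let ?D = "{u \<in> S'. \<exists>v\<in>V - S'. lab v = a \<and> E u v}"
    show "card ?D \<le> 2 * k"
    proof (cases "?D = {}")
      case False
      then obtain v where v: "v \<in> V - S'" "lab v = a" by blast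
      have a_n: "a < n" using lab(1)[OF v(1)] v anc_le top_n by (force intro: le_less_trans)
      \<comment> \<open>\<open>m\<close> is the topmost deleted node below \<open>a\<close>; if
        there is none, the default \<open>a\<close> still gives a node \<open>m < n\<close>.\<close>
      define m where "m = (if \<exists>x\<in>M'. a \<preceq> x then LEAST x. x \<in> M' \<and> a \<preceq> x else a)"
      have m_least: "m \<in> M'" "a \<preceq> m" "m \<le> x" if "x \<in> M'" "a \<preceq> x" for x
        using that LeastI[of "\<lambda>x. x \<in> M' \<and> a \<preceq> x" x] Least_le[of "\<lambda>x. x \<in> M' \<and> a \<preceq> x" x]
        by (auto simp: m_def)
      have m_n: "m < n" using m_least(1) M'_n a_n by (cases "\<exists>x\<in>M'. a \<preceq> x") (auto simp: m_def)
      \<comment> \<open>For nodes \<open>b1\<close>, \<open>b2\<close> of \<open>M\<close> below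
        \<open>m\<close> and \<open>x\<close>, their lowest common ancestor is again in
        \<open>M'\<close> and below \<open>a\<close>. Minimality puts \<open>m\<close> above it, and
        comparison on the path to \<open>b2\<close> then puts \<open>m\<close> above
        \<open>x\<close>.\<close>
      have m_anc: "m \<preceq> x" if x: "x \<in> M'" "a \<preceq> x" for x
      proof -
        have ex: "\<exists>b\<in>M. y \<preceq> b" if "y \<in> M'" for y
        proof -
          obtain b b' where "b \<in> M" "b' \<in> M" "y = lca b b'" using \<open>y \<in> M'\<close> by (auto simp: M'_def)
          then show ?thesis using lca(1) M_n by blast
        qed
        obtain b1 where b1: "b1 \<in> M" "m \<preceq> b1" using ex m_least(1)[OF x] by blast
        obtain b2 where b2: "b2 \<in> M" "x \<preceq> b2" using ex x by blast
        note bn = M_n[OF b1(1)] M_n[OF b2(1)]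
        have "a \<preceq> lca b1 b2" using lca(3)[OF bn] b1 b2 x m_least(2)[OF x] anc_trans by blast
        moreover have "lca b1 b2 \<in> M'" using b1 b2 by (force simp: M'_def)
        ultimately have "m \<le> lca b1 b2" using m_least(3) by blast
        then have "m \<preceq> lca b1 b2" using anc_of_le b1 lca(1)[OF bn] by blast
        then have "m \<preceq> b2" using lca(2)[OF bn] anc_trans by blast
        then show ?thesis using anc_of_le b2 m_least(3)[OF x] by blast
      qed
      \<comment> \<open>If \<open>top_node u\<close> is at or above \<open>a\<close>, then
        \<open>u\<close> is in \<open>B a\<close>. Otherwise \<open>u\<close> is in a deleted bag
        \<open>x\<close> below \<open>a\<close>; the clear path from \<open>a\<close> to
        \<open>i\<close> keeps \<open>m\<close> from lying above \<open>top_node u\<close>, so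
        \<open>m\<close> lies between \<open>top_node u\<close> and \<open>x\<close>, and
        \<open>u\<close> is in \<open>B m\<close>.\<close>
      have "?D \<subseteq> B a \<union> B m"
      proof
        fix u assume "u \<in> ?D"
        then obtain v where u: "u \<in> S'" and v: "v \<in> V - S'" "lab v = a" "E u v" by blast
        have "u \<in> V" using u \<open>S' \<subseteq> V\<close> by blast
        then obtain i where i: "i < n" "u \<in> B i" "v \<in> B i" using edge v by blast
        have a: "a \<preceq> i" using lab(1)[OF v(1)] v(2) top_node_anc[of i v] i anc_trans by blast
        have free: "clear a i"
          using clear_join lab(2)[OF v(1)] v clear_bag[of v i] i top_node_anc[of i v] by blast
        have tu: "top_node u \<preceq> i" using top_node_anc i by blast
        show "u \<in> B a \<union> B m"
        proof (cases "top_node u \<le> a")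
          case True
          then show ?thesis using bag_between a i by blast
        next
          case False
          then have atu: "a \<preceq> top_node u" using anc_of_le[OF a tu] by simp
          obtain x where x: "x \<in> M'" "u \<in> B x" using u by (auto simp: S'_def)
          have tx: "top_node u \<preceq> x" using top_node_anc x M'_n by blast
          have ax: "a \<preceq> x" using atu tx anc_trans by blast
          have "\<not> m \<preceq> top_node u"
            using free tu m_least[OF x(1) ax] anc_trans by (auto simp: clear_def)
          then have "top_node u \<le> m" using anc_linear[OF tx m_anc[OF x(1) ax]] anc_le by blast
          then show ?thesis using bag_between m_anc[OF x(1) ax] x by blast
        qed
      qed
      then have "card ?D \<le> card (B a \<union> B m)"
        using finite_bag a_n m_n by (intro card_mono) auto
      also have "\<dots> \<le> card (B a) + card (B m)" by (rule card_Un_le)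
      also have "\<dots> \<le> 2 * k" using card_bag[OF a_n] card_bag[OF m_n] by simp
      finally show ?thesis .
    qed (simp only: card.empty)
  qed
  ultimately show ?thesis by blast
qed

end

section \<open>Multigraphs and their tree decompositions\<close>

text \<open>For \<open>n \<noteq> 2\<close> distinct positions have distinct pairs of ends, so the
  chosen edges are distinct; for \<open>n = 2\<close> one edge could serve twice.\<close>

lemma contains_cycleI:
  fixes T :: "('v, 'e) mgraph"
  assumes n: "1 \<le> n" "n \<noteq> 2" and T: "fin_mgraph T" and inj: "inj_on f {..<n}"
    and edge: "\<And>j. j < n \<Longrightarrow> (f j, f (Suc j mod n)) \<in> adj_rel T"
  shows "contains_copy T (cycle_graph n)"
proof -
  obtain g where g: "\<And>j. j < n \<Longrightarrow> g j \<in> edges T \<and> ends T (g j) = Upair (f j) (f (Suc j mod n))"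
    using edge unfolding adj_rel_def by (simp add: Bex_def) metis
  have inj_g: "inj_on g {..<n}"
  proof
    fix i j assume ij: "i \<in> {..<n}" "j \<in> {..<n}" "g i = g j"
    then have "Upair (f i) (f (Suc i mod n)) = Upair (f j) (f (Suc j mod n))" using g by (metis lessThan_iff)
    then have "i = j \<or> (f i = f (Suc j mod n) \<and> f (Suc i mod n) = f j)"
      using ij inj by (auto simp: Upair_inject inj_on_eq_iff)
    moreover have "Suc i mod n < n" "Suc j mod n < n" using n by auto
    ultimately have "i = j \<or> (i = Suc j mod n \<and> j = Suc i mod n)"
      using ij inj by (auto simp: inj_on_eq_iff)
    then show "i = j" using ij n by (auto simp: mod_Suc split: if_splits)
  qed
  define H where "H = \<lparr>verts = f ` {..<n}, edges = g ` {..<n}, ends = ends T\<rparr>"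
  have fv: "f j \<in> verts T" if "j < n" for j
    using g[OF that] T by (fastforce simp: fin_mgraph_def)
  have mod_n: "Suc j mod n < n" for j using n by simp
  have "subgraph H T"
    using g fv mod_n by (auto simp: subgraph_def H_def fin_mgraph_def)
  moreover have "isomorphic (cycle_graph n) H"
    unfolding isomorphic_def
  proof (intro exI conjI)
    show "bij_betw f (verts (cycle_graph n)) (verts H)"
      using inj by (simp add: cycle_graph_def H_def bij_betw_def)
    show "bij_betw g (edges (cycle_graph n)) (edges H)"
      using inj_g by (simp add: cycle_graph_def H_def bij_betw_def)
    show "\<forall>e\<in>edges (cycle_graph n). ends H (g e) = map_uprod f (ends (cycle_graph n) e)"
      using g by (simp add: cycle_graph_def H_def)
  qed
  ultimately show ?thesis by (auto simp: contains_copy_def)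
qed

section \<open>Induced subgraphs, leaves and leaf-by-leaf ordering of trees\<close>

lemma sym_adj_rel: "(u, v) \<in> adj_rel G \<Longrightarrow> (v, u) \<in> adj_rel G"
  by (auto simp: adj_rel_def Upair_inject) (metis Upair_inject)

lemma adj_rel_verts:
  assumes "fin_mgraph G" "(u, v) \<in> adj_rel G" shows "u \<in> verts G" "v \<in> verts G"
  using assms by (fastforce simp: fin_mgraph_def adj_rel_def)+

lemma adj_rel_induced:
  "adj_rel (induced G S) = {(u, v) \<in> adj_rel G. u \<in> S \<and> v \<in> S}"
  by (auto simp: adj_rel_def induced_def)

lemma induced_induced: "induced (induced G S) R = induced G (S \<inter> R)"
  by (auto simp: induced_def)

lemma fin_mgraph_induced: "fin_mgraph G \<Longrightarrow> fin_mgraph (induced G S)"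
  by (auto simp: fin_mgraph_def induced_def)

lemma contains_copy_induced:
  assumes "contains_copy (induced G S) K" shows "contains_copy G K"
  using assms by (fastforce simp: contains_copy_def subgraph_def induced_def)

text \<open>An end of a longest path is a leaf.\<close>

lemma tree_leaf_exists:
  assumes T: "tree_graph T" and two: "x \<in> verts T" "y \<in> verts T" "x \<noteq> y"
  shows "\<exists>l\<in>verts T. \<exists>q\<in>verts T. l \<noteq> q \<and> (\<forall>z. (l, z) \<in> adj_rel T \<longrightarrow> z = q)"
proof -
  have fin: "fin_mgraph T" and con: "connected_graph T"
    and acyc: "\<And>n. 1 \<le> n \<Longrightarrow> \<not> contains_copy T (cycle_graph n)"
    using T by (auto simp: tree_graph_def)
  define path where "path xs \<longleftrightarrow> distinct xs \<and> set xs \<subseteq> verts T \<and>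
    (\<forall>i. Suc i < length xs \<longrightarrow> (xs ! i, xs ! Suc i) \<in> adj_rel T)" for xs
  have noloop: "(z, z) \<notin> adj_rel T" for z
    using acyc[of 1] contains_cycleI[of 1 T "\<lambda>_. z"] fin by (auto simp: inj_on_def)
  have "(x, y) \<in> (adj_rel T)\<^sup>*" using con two by (auto simp: connected_graph_def)
  then obtain z where z: "(x, z) \<in> adj_rel T" using two by (auto elim: converse_rtranclE)
  have "path [x, z]" using z noloop[of x] adj_rel_verts[OF fin z] by (auto simp: path_def)
  moreover have "length xs \<le> card (verts T)" if "path xs" for xs
    using that fin distinct_card[of xs] card_mono[of "verts T" "set xs"]
    by (auto simp: path_def fin_mgraph_def)
  ultimately have "\<exists>xs. path xs \<and> (\<forall>ys. path ys \<longrightarrow> length ys \<le> length xs)"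
    by (intro ex_has_greatest_nat[of path "[x, z]" length "Suc (card (verts T))"])
      (auto simp: less_Suc_eq_le)
  then obtain xs where xs: "path xs" and longest: "\<And>ys. path ys \<Longrightarrow> length ys \<le> length xs"
    by blast
  have len: "2 \<le> length xs" using longest[OF \<open>path [x, z]\<close>] by simp
  define l q where "l = xs ! 0" and "q = xs ! 1"
  have "l \<in> set xs" "q \<in> set xs" unfolding l_def q_def using len by (auto intro!: nth_mem)
  then have "l \<in> verts T" "q \<in> verts T" using xs by (auto simp: path_def)
  moreover have "l \<noteq> q"
  proof -
    have "distinct xs" "0 < length xs" "1 < length xs" using xs len by (auto simp: path_def)
    then show ?thesis unfolding l_def q_def by (metis nth_eq_iff_index_eq zero_neq_one)
  qed
  \<comment> \<open>A second neighbour off the path would extend it; one on the path has position at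
    least 2 and closes a cycle with at least three edges.\<close>
  moreover have "y = q" if y: "(l, y) \<in> adj_rel T" for y
  proof (rule ccontr)
    assume "y \<noteq> q"
    show False
    proof (cases "y \<in> set xs")
      case False
      have "((y # xs) ! i, (y # xs) ! Suc i) \<in> adj_rel T" if "Suc i < length (y # xs)" for i
        using that xs sym_adj_rel[OF y] by (cases i) (auto simp: path_def l_def)
      then have "path (y # xs)"
        using xs False adj_rel_verts[OF fin y] by (auto simp: path_def simp del: nth_Cons_Suc)
      then show False using longest[of "y # xs"] by simp
    next
      case True
      then obtain i where i: "i < length xs" "xs ! i = y" by (auto simp: in_set_conv_nth)
      have "i \<noteq> 0" using noloop y i(2) unfolding l_def by metis
      moreover have "i \<noteq> 1" using i \<open>y \<noteq> q\<close> by (auto simp: q_def)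
      ultimately have "2 \<le> i" by simp
      have "contains_copy T (cycle_graph (Suc i))"
      proof (rule contains_cycleI[OF _ _ fin])
        show "inj_on ((!) xs) {..<Suc i}"
          using xs i by (auto simp: path_def inj_on_def nth_eq_iff_index_eq)
        fix j assume "j < Suc i"
        then show "(xs ! j, xs ! (Suc j mod Suc i)) \<in> adj_rel T"
          using xs i sym_adj_rel[OF y] by (cases "j = i") (auto simp: path_def l_def)
      qed (use \<open>2 \<le> i\<close> in auto)
      then show False using acyc[of "Suc i"] by simp
    qed
  qed
  ultimately show ?thesis by blast
qed

text \<open>A walk that visits \<open>l\<close> enters and leaves through \<open>q\<close>, so the
  visit can be cut out.\<close>

lemma connected_remove_leaf:
  assumes con: "connected_graph (induced T S)" and leaf: "\<And>z. (l, z) \<in> adj_rel T \<Longrightarrow> z = q"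
    and ne: "verts T \<inter> S \<noteq> {l}" "l \<noteq> q" 
  shows "connected_graph (induced T (S - {l}))"
proof -
  \<comment> \<open>The second claim covers walks that currently stand at \<open>l\<close>: their
    shortened form waits at \<open>q\<close>.\<close>
  have reach: "v \<noteq> l \<longrightarrow> (u, v) \<in> (adj_rel (induced T (S - {l})))\<^sup>*"
    "v = l \<longrightarrow> (u, q) \<in> (adj_rel (induced T (S - {l})))\<^sup>*"
    if "(u, v) \<in> (adj_rel (induced T S))\<^sup>*" "u \<noteq> l" for u v
    using that(1)
  proof (induction rule: rtrancl_induct)
    case (step v w)
    { case 1
      show ?case
      proof (cases "v = l")
        case True
        then have "w = q" using leaf step by (auto simp: adj_rel_induced)
        then show ?thesis using step True by simp
      next
        case False
        then show ?thesis using step by (auto simp: adj_rel_induced intro: rtrancl_into_rtrancl)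
      qed
    next
      case 2
      show ?case
      proof
        assume "w = l"
        then have "(l, v) \<in> adj_rel T" using step sym_adj_rel[of v l] by (auto simp: adj_rel_induced)
        then have "v = q" by (rule leaf)
        then show "(u, q) \<in> (adj_rel (induced T (S - {l})))\<^sup>*" using step ne by simp
      qed }
  qed (use that in auto)
  moreover have "verts T \<inter> S \<noteq> {}" using con by (auto simp: connected_graph_def induced_def)
  then have "verts T \<inter> (S - {l}) \<noteq> {}" using ne by blast
  ultimately show ?thesis using con by (auto simp: connected_graph_def induced_def)
qed

text \<open>A leaf is removed, the rest is numbered by induction, and the leaf gets the last number
  with its neighbour as parent. The sets \<open>{x. v \<in> B x}\<close> are not intersected with
  \<open>verts T\<close>, so the hypothesis keeps its form for the smaller tree.\<close>

lemma tree_bag_order: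
  assumes "tree_graph T" and "\<And>v. \<exists>x\<in>verts T. v \<in> B x \<Longrightarrow> connected_graph (induced T {x. v \<in> B x})"
  shows "\<exists>n f p. bij_betw f {..<n::nat} (verts T) \<and> (\<forall>i. 0 < i \<and> i < n \<longrightarrow> p i < i) \<and>
    (\<forall>i<n. \<forall>j<i. \<forall>v. v \<in> B (f i) \<longrightarrow> v \<in> B (f j) \<longrightarrow> v \<in> B (f (p i)))"
  using assms
proof (induction "card (verts T)" arbitrary: T rule: less_induct)
  case less
  then have T: "tree_graph T" and finT: "fin_mgraph T" and neT: "verts T \<noteq> {}"
    by (auto simp: tree_graph_def connected_graph_def)
  show ?case
  proof (cases "\<exists>x y. x \<in> verts T \<and> y \<in> verts T \<and> x \<noteq> y")
    case False
    then obtain x where "verts T = {x}" using neT by blast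
    then show ?thesis
      by (intro exI[of _ 1] exI[of _ "\<lambda>_. x"]) (auto simp: bij_betw_def inj_on_def)
  next
    case True
    then obtain l q where lq: "l \<in> verts T" "q \<in> verts T" "l \<noteq> q"
      and leaf: "\<And>z. (l, z) \<in> adj_rel T \<Longrightarrow> z = q"
      using tree_leaf_exists[OF T] by blast
    define T' where "T' = induced T (- {l})"
    have vT': "verts T' = verts T - {l}" by (auto simp: T'_def induced_def)
    have ind_T: "induced T UNIV = T" if "fin_mgraph T" for T :: "('a, 'b) mgraph"
      by (simp add: induced_def)
    have "connected_graph T'"
      using connected_remove_leaf[of T UNIV l q] leaf lq T ind_T[OF finT]
      by (force simp: T'_def tree_graph_def Compl_eq_Diff_UNIV)
    then have "tree_graph T'"
      using T contains_copy_induced fin_mgraph_induced unfolding T'_def tree_graph_def by blast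
    moreover have "connected_graph (induced T' {x. v \<in> B x})" if ex: "\<exists>x\<in>verts T'. v \<in> B x" for v
    proof -
      have "connected_graph (induced T ({x. v \<in> B x} - {l}))"
        using ex less.prems(2)[of v] leaf lq
        by (intro connected_remove_leaf[of T _ l q]) (auto simp: vT')
      moreover have "{x. v \<in> B x} - {l} = - {l} \<inter> {x. v \<in> B x}" by auto
      ultimately show ?thesis by (simp add: T'_def induced_induced)
    qed
    moreover have "card (verts T') < card (verts T)"
      using lq finT unfolding vT' fin_mgraph_def by (intro card_Diff1_less) auto
    ultimately obtain n f p where f: "bij_betw f {..<n::nat} (verts T')"
      and p: "\<And>i. 0 < i \<Longrightarrow> i < n \<Longrightarrow> p i < i"
      and run: "\<And>i j v. i < n \<Longrightarrow> j < i \<Longrightarrow> v \<in> B (f i) \<Longrightarrow> v \<in> B (f j) \<Longrightarrow> v \<in> B (f (p i))"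
      using less.hyps[of T'] by metis
    have "q \<in> f ` {..<n}" using f lq vT' by (auto simp: bij_betw_def)
    then obtain k where k: "k < n" "f k = q" by auto
    \<comment> \<open>Connectivity yields an edge from \<open>l\<close> to a node whose bag contains
      \<open>v\<close>, and the only neighbour of the leaf is \<open>q\<close>.\<close>
    have leaf_run: "v \<in> B q" if v: "v \<in> B l" "x \<in> verts T" "x \<noteq> l" "v \<in> B x" for v x
    proof -
      have "connected_graph (induced T {x. v \<in> B x})" using less.prems(2) v by blast
      then have "(l, x) \<in> (adj_rel (induced T {x. v \<in> B x}))\<^sup>*"
        using v lq by (auto simp: connected_graph_def induced_def)
      then obtain z where "(l, z) \<in> adj_rel (induced T {x. v \<in> B x})"
        using v by (auto elim: converse_rtranclE)
      then show ?thesis using leaf by (auto simp: adj_rel_induced)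
    qed
    have "bij_betw (f(n := l)) {..<Suc n} (verts T)"
    proof -
      have "bij_betw (f(n := l)) ({..<n} \<union> {n}) (verts T' \<union> {l})"
      proof (rule bij_betw_combine)
        show "bij_betw (f(n := l)) {..<n} (verts T')" using f
          by (subst bij_betw_cong[of _ _ f]) auto
      qed (auto simp: vT' bij_betw_def)
      moreover have "verts T' \<union> {l} = verts T" using lq vT' by auto
      ultimately show ?thesis by (simp add: lessThan_Suc)
    qed
    moreover have "\<forall>i. 0 < i \<and> i < Suc n \<longrightarrow> (p(n := k)) i < i" using p k by (auto simp: less_Suc_eq)
    moreover have "\<forall>i<Suc n. \<forall>j<i. \<forall>v. v \<in> B ((f(n := l)) i) \<longrightarrow> v \<in> B ((f(n := l)) j) \<longrightarrow>
        v \<in> B ((f(n := l)) ((p(n := k)) i))"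
    proof (intro allI impI)
      fix i j v
      assume ij: "i < Suc n" "j < i" and v: "v \<in> B ((f(n := l)) i)" "v \<in> B ((f(n := l)) j)"
      show "v \<in> B ((f(n := l)) ((p(n := k)) i))"
      proof (cases "i = n")
        case True
        have "f j \<in> verts T'" using f ij True by (auto simp: bij_betw_def)
        then show ?thesis using leaf_run[of v "f j"] v ij True k by (auto simp: vT')
      next
        case False
        then show ?thesis using ij v run[of i j v] p[of i] by auto
      qed
    qed
    ultimately show ?thesis by blast
  qed
qed

section \<open>Treewidth and complete bipartite subgraphs\<close>

text \<open>One node with a full bag suffices. Existence makes the \<open>LEAST\<close> in
  \<open>treewidth\<close> an attained value.\<close>

lemma tree_decomposition_exists:
  assumes "fin_mgraph G"
  obtains T B where "tree_decomposition G T B"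
proof -
  define T :: "(nat, nat) mgraph" where "T = \<lparr>verts = {0}, edges = {}, ends = undefined\<rparr>"
  have "\<not> contains_copy T (cycle_graph n)" if "1 \<le> n" for n
  proof
    assume "contains_copy T (cycle_graph n)"
    then obtain g where "bij_betw g {..<n} ({} :: nat set)"
      by (auto simp: contains_copy_def subgraph_def isomorphic_def T_def cycle_graph_def)
    then have "{..<n} = {}" by (simp add: bij_betw_def)
    then show False using that by (simp add: lessThan_empty_iff)
  qed
  then have "tree_decomposition G T (\<lambda>_. verts G)"
    using assms
    by (auto simp: tree_decomposition_def tree_graph_def connected_graph_def fin_mgraph_def
        induced_def T_def)
  then show ?thesis by (rule that)
qed

lemma treewidth_bags:
  assumes G: "fin_mgraph G" and tw: "treewidth G \<le> w"
  obtains T B where "tree_decomposition G T B" "\<And>x. x \<in> verts T \<Longrightarrow> card (B x) \<le> w + 1"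
proof -
  have "\<exists>T B. tree_decomposition G T B \<and> decomposition_width T B = treewidth G"
    unfolding treewidth_def by (rule LeastI_ex) (use tree_decomposition_exists[OF G] in blast)
  then obtain T B where TB: "tree_decomposition G T B" "decomposition_width T B \<le> w"
    using tw by auto
  then have "finite (verts T)"
    by (auto simp: tree_decomposition_def tree_graph_def fin_mgraph_def)
  then have "card (B x) \<le> Max ((\<lambda>x. card (B x)) ` verts T)" if "x \<in> verts T" for x
    using that by (intro Max_ge) auto
  \<comment> \<open>Truncated subtraction does no harm: a maximum of 0 is below \<open>w + 1\<close>
    as well.\<close>
  moreover have "Max ((\<lambda>x. card (B x)) ` verts T) \<le> w + 1"
    using TB(2) by (simp add: decomposition_width_def)
  ultimately have "card (B x) \<le> w + 1" if "x \<in> verts T" for x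
    using that le_trans by blast
  with TB(1) show ?thesis by (rule that)
qed

text \<open>One edge is chosen per pair, and disjointness of \<open>X\<close> and \<open>Y\<close>
  makes the chosen edges distinct. By \<open>s \<ge> 1\<close> each vertex of \<open>Y\<close> has a
  neighbour in \<open>X\<close> and so belongs to the graph.\<close>

lemma contains_complete_bipartiteI:
  assumes G: "fin_mgraph G" and X: "X \<subseteq> verts G" "card X = s" "finite X"
    and Y: "Y \<inter> X = {}" "t \<le> card Y" "finite Y" "s \<ge> 1"
    and adj: "\<And>x y. x \<in> X \<Longrightarrow> y \<in> Y \<Longrightarrow> (x, y) \<in> adj_rel G"
  shows "contains_copy G (complete_bipartite s t)"
proof -
  obtain Y' where Y': "Y' \<subseteq> Y" "card Y' = t" using Y by (meson obtain_subset_with_card_n)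
  have finY': "finite Y'" using Y' Y finite_subset by blast
  obtain a where a: "bij_betw a {..<s} X"
    using X ex_bij_betw_nat_finite[of X] by (auto simp: atLeast0LessThan)
  obtain b where b: "bij_betw b {..<t} Y'"
    using Y' finY' ex_bij_betw_nat_finite[of Y'] by (auto simp: atLeast0LessThan)
  have aX: "i < s \<Longrightarrow> a i \<in> X" and bY: "j < t \<Longrightarrow> b j \<in> Y'" for i j
    using a b by (auto simp: bij_betw_def)
  define g where "g = (\<lambda>(i, j). SOME e. e \<in> edges G \<and> ends G e = Upair (a i) (b j))"
  have g: "g (i, j) \<in> edges G" "ends G (g (i, j)) = Upair (a i) (b j)" if "i < s" "j < t" for i j
    using adj[OF aX[OF that(1)], of "b j"] bY[OF that(2)] Y'
      someI_ex[of "\<lambda>e. e \<in> edges G \<and> ends G e = Upair (a i) (b j)"]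
    by (auto simp: adj_rel_def g_def)
  have ab: "a i \<noteq> b j" if "i < s" "j < t" for i j using aX bY that Y Y' by fastforce
  have inj_g: "inj_on g ({..<s} \<times> {..<t})"
  proof (intro inj_onI, clarify)
    fix i j i' j' assume lt: "i < s" "j < t" "i' < s" "j' < t" and eq: "g (i, j) = g (i', j')"
    then have "Upair (a i) (b j) = Upair (a i') (b j')" using g by metis
    then have "a i = a i'" "b j = b j'" using ab lt by (auto simp: Upair_inject)
    then show "i = i' \<and> j = j'" using a b lt by (auto simp: bij_betw_def inj_on_def)
  qed
  define f where "f = case_sum a b"
  define H where "H = \<lparr>verts = X \<union> Y', edges = g ` ({..<s} \<times> {..<t}), ends = ends G\<rparr>"
  have "y \<in> verts G" if "y \<in> Y'" for y
  proof -
    obtain x where "x \<in> X" using X Y by (metis card.empty equals0I not_one_le_zero)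
    then show ?thesis using adj_rel_verts(2)[OF G adj] that Y' by blast
  qed
  then have "subgraph H G"
    using X finY' g aX bY by (auto simp: subgraph_def H_def fin_mgraph_def)
  moreover have "isomorphic (complete_bipartite s t) H"
    unfolding isomorphic_def
  proof (intro exI conjI)
    show "bij_betw f (verts (complete_bipartite s t)) (verts H)"
      unfolding bij_betw_def
    proof
      show "inj_on f (verts (complete_bipartite s t))"
        using a b ab by (fastforce simp: complete_bipartite_def f_def bij_betw_def inj_on_def)
      have "f ` (Inl ` {..<s} \<union> Inr ` {..<t}) = a ` {..<s} \<union> b ` {..<t}"
        by (simp add: image_Un image_image f_def)
      then show "f ` verts (complete_bipartite s t) = verts H"
        using a b by (simp add: complete_bipartite_def H_def bij_betw_def Plus_def)
    qed
    show "bij_betw g (edges (complete_bipartite s t)) (edges H)"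
      using inj_g by (simp add: complete_bipartite_def H_def bij_betw_def)
    show "\<forall>e\<in>edges (complete_bipartite s t). ends H (g e) = map_uprod f (ends (complete_bipartite s t) e)"
      using g by (auto simp: complete_bipartite_def H_def f_def)
  qed
  ultimately show ?thesis by (auto simp: contains_copy_def)
qed

text \<open>This supplies the hypothesis \<open>separator\<close>: \<open>tree_bag_order\<close>
  roots the decomposition tree, whose bags have at most \<open>w + 1\<close> vertices.\<close>

lemma treewidth_separator:
  fixes G :: "('v, 'e) mgraph"
  assumes G: "fin_mgraph G" and tw: "treewidth G \<le> w" and S: "S \<subseteq> verts G"
  shows "\<exists>S' (lab :: 'v \<Rightarrow> nat). S \<subseteq> S' \<and> S' \<subseteq> verts G \<and> card S' \<le> card S * card S * (w + 1) \<and>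
      (\<forall>u\<in>verts G - S'. \<forall>v\<in>verts G - S'. (u, v) \<in> adj_rel G \<longrightarrow> lab u = lab v) \<and>
      (\<forall>a. card {u \<in> S'. \<exists>v\<in>verts G - S'. lab v = a \<and> (u, v) \<in> adj_rel G} \<le> 2 * (w + 1))"
proof -
  obtain T B where TB: "tree_decomposition G T B" and width: "\<And>x. x \<in> verts T \<Longrightarrow> card (B x) \<le> w + 1"
    using treewidth_bags[OF G tw] by blast
  have T: "tree_graph T" and cover: "(\<Union>x\<in>verts T. B x) = verts G"
    and edge: "\<And>e. e \<in> edges G \<Longrightarrow> \<exists>x\<in>verts T. set_uprod (ends G e) \<subseteq> B x"
    and con: "\<And>v. v \<in> verts G \<Longrightarrow> connected_graph (induced T {x \<in> verts T. v \<in> B x})"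
    using TB by (auto simp: tree_decomposition_def)
  have finT: "fin_mgraph T" using T by (simp add: tree_graph_def)
  have "induced T {x \<in> verts T. v \<in> B x} = induced T {x. v \<in> B x}" for v
    using finT by (auto simp: induced_def fin_mgraph_def)
  then have "\<exists>x\<in>verts T. v \<in> B x \<Longrightarrow> connected_graph (induced T {x. v \<in> B x})" for v
    using con cover by auto
  from tree_bag_order[OF T this] obtain n f p where f: "bij_betw f {..<n::nat} (verts T)"
    and p: "\<And>i. 0 < i \<Longrightarrow> i < n \<Longrightarrow> p i < i"
    and run: "\<And>i j v. i < n \<Longrightarrow> j < i \<Longrightarrow> v \<in> B (f i) \<Longrightarrow> v \<in> B (f j) \<Longrightarrow> v \<in> B (f (p i))"
    by metis
  have f_in: "f i \<in> verts T" if "i < n" for i using f that by (auto simp: bij_betw_def)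
  have f_onto: "\<exists>i<n. f i = x" if "x \<in> verts T" for x
  proof -
    have "x \<in> f ` {..<n}" using f that by (simp add: bij_betw_def)
    then show ?thesis by auto
  qed
  have bag_sub: "B (f i) \<subseteq> verts G" if "i < n" for i using cover f_in[OF that] by blast
  have finG: "finite (verts G)" using G by (simp add: fin_mgraph_def)
  interpret rooted_bags n p "\<lambda>i. B (f i)" "w + 1"
  proof
    show "finite (B (f i))" if "i < n" for i using bag_sub[OF that] finG by (rule finite_subset)
    show "v \<in> B (f (p i))" if "i < n" "v \<in> B (f i)" "j < i" "v \<in> B (f j)" for i j v
      using run that by blast
  qed (use p width f_in in auto)
  show ?thesis
  proof (rule separator_exists)
    show "\<exists>i<n. v \<in> B (f i)" if "v \<in> verts G" for v using that cover f_onto by blast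
    show "\<exists>i<n. u \<in> B (f i) \<and> v \<in> B (f i)" if "(u, v) \<in> adj_rel G" for u v
    proof -
      obtain e where "e \<in> edges G" "ends G e = Upair u v"
        using \<open>(u, v) \<in> adj_rel G\<close> by (auto simp: adj_rel_def)
      then obtain x where "x \<in> verts T" "u \<in> B x" "v \<in> B x" using edge by fastforce
      then show ?thesis using f_onto by blast
    qed
  qed (use S finG bag_sub in \<open>auto intro: finite_subset\<close>)
qed

theorem theorem5:
  fixes s t w :: nat
  assumes "s \<ge> 1" and "t \<ge> 1" and "w \<ge> 1"
  shows "\<exists>\<eta>::nat. \<eta> \<ge> 1 \<and>
    (\<forall>G :: ('v, 'e) mgraph.
       fin_mgraph G \<and> treewidth G \<le> w \<and> \<not> contains_copy G (complete_bipartite s t) \<longrightarrow>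
       choosable_with_clustering G (s + 1) \<eta>)"
proof -
  \<comment> \<open>Both come from \<open>treewidth_separator\<close>: the bags at common ancestors
    of at most \<open>m * m\<close> pairs of nodes, and attachments within two bags.\<close>
  define h :: "nat \<Rightarrow> nat" where "h m = m * m * (w + 1)" for m
  define \<theta> where "\<theta> = 2 * (w + 1)"
  have "choosable_with_clustering G (s + 1) (Suc (cluster_bound t \<theta> h))"
    if G: "fin_mgraph G" "treewidth G \<le> w" "\<not> contains_copy G (complete_bipartite s t)"
    for G :: "('v, 'e) mgraph"
    unfolding choosable_with_clustering_def
  proof (intro allI impI)
    fix L :: "'v \<Rightarrow> int set" assume L: "list_assignment (s + 1) G L"
    have finG: "finite (verts G)" using G by (simp add: fin_mgraph_def)
    interpret separable_graph "verts G" "\<lambda>u v. (u, v) \<in> adj_rel G" s t \<theta> h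
    proof
      show "card {v \<in> verts G - X. \<forall>x\<in>X. (x, v) \<in> adj_rel G} < t"
        if X: "X \<subseteq> verts G" "card X = s" for X
      proof (rule ccontr)
        let ?Y = "{v \<in> verts G - X. \<forall>x\<in>X. (x, v) \<in> adj_rel G}"
        assume "\<not> ?thesis"
        then have "t \<le> card ?Y" by simp
        moreover have "finite X" using X(1) finG by (rule finite_subset)
        ultimately have "contains_copy G (complete_bipartite s t)"
          using X finG assms(1) by (intro contains_complete_bipartiteI[OF G(1), of X s ?Y]) auto
        then show False using G by blast
      qed
      show "mono h" unfolding h_def by (intro monoI mult_le_mono) auto
    qed (use finG sym_adj_rel treewidth_separator[OF G(1,2)] in \<open>auto simp: h_def \<theta>_def\<close>)
    \<comment> \<open>At the start nothing is precoloured, so \<open>W\<close> and \<open>Y\<close>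
      are empty and \<open>V\<close> is the whole graph.\<close>
    obtain c where c: "\<And>v. v \<in> verts G \<Longrightarrow> c v \<in> L v"
      and small: "\<And>v. v \<in> verts G \<Longrightarrow>
        card ((mono_rel (\<lambda>u v. (u, v) \<in> adj_rel G) (verts G) c)\<^sup>* `` {v}) \<le> cluster_bound t \<theta> h"
      using extend_coloring[of L "verts G" "{}" "{}"] L assms by (auto simp: list_assignment_def)
    have "card K \<le> cluster_bound t \<theta> h" if K: "K \<in> monochromatic_components G c" for K
    proof -
      obtain a v where av: "v \<in> verts G"
        "K = (adj_rel (induced G {v \<in> verts G. c v = a}))\<^sup>* `` {v}"
        using K by (auto simp: monochromatic_components_def components_of_def quotient_def induced_def)
      let ?R = "mono_rel (\<lambda>u v. (u, v) \<in> adj_rel G) (verts G) c"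
      have "adj_rel (induced G {v \<in> verts G. c v = a}) \<subseteq> ?R"
        by (auto simp: adj_rel_induced mono_rel_def)
      then have "K \<subseteq> ?R\<^sup>* `` {v}" unfolding av(2) by (intro Image_mono rtrancl_mono) auto
      moreover have "?R\<^sup>* `` {v} \<subseteq> verts G" using mono_rel_reach av(1) by fastforce
      ultimately have "card K \<le> card (?R\<^sup>* `` {v})" using finG by (meson card_mono finite_subset)
      then show ?thesis using small[OF av(1)] by simp
    qed
    then show "\<exists>c. list_coloring G L c \<and> has_clustering G c (Suc (cluster_bound t \<theta> h))"
      using c by (intro exI[of _ c]) (auto simp: list_coloring_def has_clustering_def le_Suc_eq)
  qed
  then show ?thesis by (intro exI[of _ "Suc (cluster_bound t \<theta> h)"]) auto
qed

end
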